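(* Let $\{(N_k,B_k)\}_{k=1}^\infty$ be a sequence of admissible pairs, all of whose terms are chosen from a finite set of admissible pairs, and let $$\mu = \delta_{N_{1}^{-1} B_1} * \delta_{(N_1 N_2)^{-1} B_2} * \cdots * \delta_{(N_1 N_2 \cdots N_k)^{-1} B_k } * \cdots$$ be the associated infinite convolution. If for each $k\ge 1$, $$\gcd\left(\bigcup_{j=k}^\infty (B_j-B_j)\right)=1,$$ then $\mathcal{Z}(\mu)=\emptyset$.
   Context: For a finite nonempty set $A\subset\mathbb{R}$, $\delta_A=\frac{1}{\#A}\sum_{a\in A}\delta_a$, where $\delta_a$ is the Dirac measure at $a$; $cA=\{ca: a\in A\}$. A Borel probability measure $\mu$ on $\mathbb{R}$ is a spectral measure if there is a set $\Lambda\subset\mathbb{R}$, called a spectrum of $\mu$, such that $\{e^{2\pi i\lambda x}:\lambda\in\Lambda\}$ is an orthonormal basis of $L^2(\mu)$. Given an integer $N$ with $|N|\ge 2$ and a finite set $B\subset\mathbb{Z}$ with $\#B\ge 2$, $(N,B)$ is an admissible pair if the discrete measure $\delta_{N^{-1}B}$ admits a spectrum $L\subset\mathbb{Z}$, i.e. the matrix $\left(\frac{1}{\sqrt{\#B}}e^{-2\pi i b\ell/N}\right)_{b\in B,\ell\in L}$ is unitary. The infinite convolution is the weak limit (against bounded continuous functions) of its finite partial convolutions. $B-B=\{b-b':b,b'\in B\}$, and $\gcd$ of a set of integers is the greatest common divisor of all its elements. The Fourier transform is $\widehat{\mu}(\xi)=\int_{\mathbb{R}}e^{-2\pi i\xi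 x}\,d\mu(x)$, and $\mathcal{Z}(\mu)=\{\xi\in\mathbb{R}:\widehat{\mu}(\xi+k)=0\text{ for all }k\in\mathbb{Z}\}$. *)

theory Defs
  imports "HOL-Probability.Probability"
begin

definition uniform_dirac :: "real set \<Rightarrow> real measure" where
  "uniform_dirac A = distr (measure_pmf (pmf_of_set A)) borel (\<lambda>x. x)"

text \<open>
  The matrix \<open>A\<close> has rows indexed by \<open>I\<close> and columns indexed by \<open>J\<close>; both
  \<open>A A\<^sup>* = 1\<close> and \<open>A\<^sup>* A = 1\<close> are required, which also forces \<open>card I = card J\<close>.
\<close>
definition unitary_on :: "'a set \<Rightarrow> 'b set \<Rightarrow> ('a \<Rightarrow> 'b \<Rightarrow> complex) \<Rightarrow> bool" where
  "unitary_on I J A \<longleftrightarrow> finite I \<and> finite J \<and>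
     (\<forall>i\<in>I. \<forall>i'\<in>I. (\<Sum>j\<in>J. A i j * cnj (A i' j)) = (if i = i' then 1 else 0)) \<and>
     (\<forall>j\<in>J. \<forall>j'\<in>J. (\<Sum>i\<in>I. cnj (A i j) * A i j') = (if j = j' then 1 else 0))"

definition admissible_pair :: "int \<Rightarrow> int set \<Rightarrow> bool" where
  "admissible_pair N B \<longleftrightarrow> \<bar>N\<bar> \<ge> 2 \<and> finite B \<and> card B \<ge> 2 \<and>
     (\<exists>L :: int set. unitary_on B L (\<lambda>b l.
        1 / complex_of_real (sqrt (real (card B))) *
        exp (- 2 * complex_of_real pi * \<i> * of_int b * of_int l / of_int N)))"

text \<open>The sequence is indexed from 1; the value \<open>\<nu> 0\<close> is not used, and the
  empty convolution is the Dirac measure at 0.\<close>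
primrec partial_convolution :: "(nat \<Rightarrow> real measure) \<Rightarrow> nat \<Rightarrow> real measure" where
  "partial_convolution \<nu> 0 = return borel 0"
| "partial_convolution \<nu> (Suc n) = (partial_convolution \<nu> n \<star> \<nu> (Suc n))"

definition weak_limit :: "(nat \<Rightarrow> real measure) \<Rightarrow> real measure \<Rightarrow> bool" where
  "weak_limit M \<mu> \<longleftrightarrow> (\<forall>f :: real \<Rightarrow> real. continuous_on UNIV f \<and> bounded (range f) \<longrightarrow>
     (\<lambda>n. \<integral>x. f x \<partial>M n) \<longlonglongrightarrow> (\<integral>x. f x \<partial>\<mu>))"

text \<open>On probability measures this is the library's notion of weak convergence.\<close>
lemma weak_limit_iff_weak_conv_m:
  assumes "\<And>n. real_distribution (M n)" and "real_distribution \<mu>"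
  shows "weak_limit M \<mu> \<longleftrightarrow> weak_conv_m M \<mu>"
proof
  assume *: "weak_limit M \<mu>"
  show "weak_conv_m M \<mu>"
  proof (rule integral_bdd_continuous_conv_imp_weak_conv[OF assms])
    fix f :: "real \<Rightarrow> real"
    assume f: "\<And>x. isCont f x" "\<And>x. \<bar>f x\<bar> \<le> 1"
    then have "continuous_on UNIV f" "bounded (range f)"
      by (auto intro!: continuous_at_imp_continuous_on boundedI[where B = 1])
    with * show "(\<lambda>n. integral\<^sup>L (M n) f) \<longlonglongrightarrow> integral\<^sup>L \<mu> f"
      by (auto simp: weak_limit_def)
  qed
next
  assume *: "weak_conv_m M \<mu>"
  show "weak_limit M \<mu>"
    unfolding weak_limit_def
  proof (intro allI impI, elim conjE)
    fix f :: "real \<Rightarrow> real"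
    assume f: "continuous_on UNIV f" "bounded (range f)"
    then obtain C where "\<And>x. norm (f x) \<le> C"
      by (auto simp: bounded_iff)
    with f show "(\<lambda>n. integral\<^sup>L (M n) f) \<longlonglongrightarrow> integral\<^sup>L \<mu> f"
      by (intro weak_conv_imp_integral_bdd_continuous_conv[OF assms *])
         (auto simp: continuous_on_eq_continuous_at)
  qed
qed

definition is_infinite_convolution :: "(nat \<Rightarrow> real measure) \<Rightarrow> real measure \<Rightarrow> bool" where
  "is_infinite_convolution \<nu> \<mu> \<longleftrightarrow>
     real_distribution \<mu> \<and> weak_limit (partial_convolution \<nu>) \<mu>"

definition convolution_factor :: "(nat \<Rightarrow> int) \<Rightarrow> (nat \<Rightarrow> int set) \<Rightarrow> nat \<Rightarrow> real measure" where
  "convolution_factor N B k =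
     uniform_dirac ((\<lambda>b. inverse (real_of_int (\<Prod>j=1..k. N j)) * real_of_int b) ` B k)"

definition difference_set :: "int set \<Rightarrow> int set" where
  "difference_set B = {b - b' | b b'. b \<in> B \<and> b' \<in> B}"

definition fourier :: "real measure \<Rightarrow> real \<Rightarrow> complex" where
  "fourier \<mu> \<xi> = (CLINT x|\<mu>. exp (- 2 * complex_of_real pi * \<i> * complex_of_real \<xi> * complex_of_real x))"

definition periodic_zeros :: "real measure \<Rightarrow> real set" where
  "periodic_zeros \<mu> = {\<xi>. \<forall>k :: int. fourier \<mu> (\<xi> + real_of_int k) = 0}"

end

theory Submission
  imports Defs "HOL-Complex_Analysis.Complex_Analysis"
begin

text \<open>
  A periodic zero \<open>\<xi>\<close> of \<open>\<mu>\<close> is the root of a tree: if \<open>\<zeta>\<close> is a periodic zero of the \<open>n\<close>-th tail of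
  the convolution, then so is \<open>(\<zeta> + l) / N\<^bsub>n+1\<^esub>\<close> for the next tail, for every \<open>l\<close> in a spectrum of the
  next pair at which the mask polynomial does not vanish. All nodes lie in a fixed compact interval
  and the nodes of one level are incongruent modulo 1, so the level sizes do not decrease. The
  Fourier transforms of the tails are entire functions with value 1 at 0 and a common growth bound,
  so their zeros in a disc are uniformly bounded in number, and the level sizes are eventually
  constant. From then on each node has a single child; since the squared moduli of the mask
  polynomial over the spectrum sum to 1, it has modulus 1 at that child \<open>\<eta>\<close>, whence \<open>(b - b') \<eta>\<close> is an
  integer for all digits \<open>b, b'\<close>. Integral multipliers are inherited from children by parents, and
  every difference that occurs late enough occurs infinitely often, because there are only finitely
  many pairs. So all those differences are multipliers of \<open>\<xi>\<close>, and \<open>\<xi>\<close> is an integer as their gcd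
  is 1. But then \<open>0\<close> is a zero of the Fourier transform of \<open>\<mu>\<close>, which is absurd.
\<close>

section \<open>Zeros of entire functions\<close>

text \<open>A Jensen-type bound obtained by dividing out zeros one at a time. For a zero
  \<open>a\<close> in the disc of radius \<open>R\<close>, the factor \<open>z - a\<close> has
  modulus at least \<open>2 * R\<close> on the circle of radius \<open>3 * R\<close> but at most
  \<open>R\<close> at the origin, so each zero gains a factor 2. Without zeros this is the maximum
  modulus principle.\<close>

lemma card_zeros_le:
  fixes f :: "complex \<Rightarrow> complex"
  assumes "f holomorphic_on UNIV" and "finite S" and "S \<subseteq> cball 0 R" and "R > 0"
    and "\<And>a. a \<in> S \<Longrightarrow> f a = 0" and "\<And>z. norm z = 3 * R \<Longrightarrow> norm (f z) \<le> M"
  shows "norm (f 0) * 2 ^ card S \<le> M"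
  using assms(2,1,3-)
proof (induction S arbitrary: f M rule: finite_induct)
  case empty
  have "norm (f 0) \<le> M"
  proof (rule maximum_modulus_frontier[where S = "ball 0 (3 * R)" and f = f])
    show "f holomorphic_on interior (ball 0 (3 * R))"
      using empty.prems(1) holomorphic_on_subset by blast
    show "continuous_on (closure (ball 0 (3 * R))) f"
      using empty.prems(1) holomorphic_on_imp_continuous_on continuous_on_subset by blast
  qed (use empty.prems in \<open>auto simp: frontier_ball\<close>)
  then show ?case by simp
next
  case (insert a S)
  \<comment> \<open>The value at \<open>a\<close> removes the singularity of the quotient, so
    \<open>g\<close> is again entire.\<close>
  define g where "g = (\<lambda>z. if z = a then deriv f a else f z / (z - a))"
  have fa: "f a = 0" using insert.prems by simp
  have fg: "f z = (z - a) * g z" for z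
    using fa by (simp add: g_def)
  have a: "norm a \<le> R" using insert.prems by simp
  have "norm (g 0) * 2 ^ card S \<le> M / (2 * R)"
  proof (rule insert.IH)
    show "g holomorphic_on UNIV"
      using pole_lemma_open[OF insert.prems(1), of a] fa by (simp add: g_def cong: if_cong)
    show "g b = 0" if "b \<in> S" for b
      using that insert.prems(4)[of b] insert.hyps fg[of b] by auto
    show "norm (g z) \<le> M / (2 * R)" if z: "norm z = 3 * R" for z
    proof -
      have "2 * R \<le> norm (z - a)"
        using norm_triangle_ineq2[of z a] a z by simp
      then have "2 * R * norm (g z) \<le> norm (z - a) * norm (g z)"
        by (rule mult_right_mono) simp
      also have "\<dots> \<le> M"
        using insert.prems(5)[OF z] by (simp add: fg norm_mult)
      finally show ?thesis
        using \<open>R > 0\<close> by (simp add: field_simps)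
    qed
  qed (use insert.prems in auto)
  then have *: "2 * R * norm (g 0) * 2 ^ card S \<le> M"
    using \<open>R > 0\<close> by (simp add: field_simps)
  have "norm (f 0) * 2 ^ card (insert a S) = 2 * norm a * norm (g 0) * 2 ^ card S"
    using insert.hyps by (simp add: fg norm_mult)
  also have "\<dots> \<le> 2 * R * norm (g 0) * 2 ^ card S"
    using a by (intro mult_right_mono mult_left_mono) auto
  finally show ?case using * by simp
qed

section \<open>Mask polynomials and their infinite products\<close>

text \<open>The Fourier transform of the uniform measure on \<open>B\<close>, taken at complex
  arguments so that zeros can be counted by complex analysis.\<close>

definition mask_poly :: "int set \<Rightarrow> complex \<Rightarrow> complex" where
  "mask_poly B z = (\<Sum>b\<in>B. exp (- 2 * complex_of_real pi * \<i> * of_int b * z)) / of_nat (card B)"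

lemma mask_poly_holomorphic [holomorphic_intros]:
  assumes "f holomorphic_on A"
  shows "(\<lambda>z. mask_poly B (f z)) holomorphic_on A"
  unfolding mask_poly_def using assms
  by (cases "card B = 0") (auto intro!: holomorphic_intros)

lemma mask_poly_0: "finite B \<Longrightarrow> B \<noteq> {} \<Longrightarrow> mask_poly B 0 = 1"
  by (simp add: mask_poly_def)

lemma mask_poly_add_int: "mask_poly B (z + of_int k) = mask_poly B z"
proof -
  have "exp (- 2 * complex_of_real pi * \<i> * of_int b * (z + of_int k)) =
    exp (- 2 * complex_of_real pi * \<i> * of_int b * z)" for b
  proof -
    have "exp (- 2 * complex_of_real pi * \<i> * of_int b * (z + of_int k)) =
      exp (- 2 * complex_of_real pi * \<i> * of_int b * z) * exp (2 * of_int (- b * k) * complex_of_real pi * \<i>)"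
      by (simp add: exp_add[symmetric] algebra_simps)
    also have "exp (2 * of_int (- b * k) * complex_of_real pi * \<i>) = 1"
      using exp_integer_2pi[of "of_int (- b * k)"] by (simp add: mult_ac)
    finally show ?thesis by simp
  qed
  then show ?thesis unfolding mask_poly_def by simp
qed

lemma norm_sum_divide_card_le:
  fixes f :: "'a \<Rightarrow> complex"
  assumes "finite B" "B \<noteq> {}" and "\<And>b. b \<in> B \<Longrightarrow> norm (f b) \<le> c"
  shows "norm ((\<Sum>b\<in>B. f b) / of_nat (card B)) \<le> c"
proof -
  have "norm (\<Sum>b\<in>B. f b) \<le> real (card B) * c"
    using sum_norm_le[of B f "\<lambda>_. c"] assms by simp
  then show ?thesis
    using assms by (simp add: norm_divide field_simps card_gt_0_iff)
qed

lemma norm_exponent_le: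
  assumes "\<bar>b\<bar> \<le> C"
  shows "norm (- 2 * complex_of_real pi * \<i> * of_int b * z) \<le> 2 * pi * of_int C * norm z"
  using assms by (simp add: norm_mult mult_right_mono)

lemma norm_mask_poly_le:
  assumes "finite B" "B \<noteq> {}" "\<And>b. b \<in> B \<Longrightarrow> \<bar>b\<bar> \<le> C"
  shows "norm (mask_poly B z) \<le> exp (2 * pi * of_int C * norm z)"
  unfolding mask_poly_def
  by (rule norm_sum_divide_card_le[OF assms(1,2)])
     (use norm_exp norm_exponent_le[OF assms(3)] in \<open>meson exp_le_cancel_iff order_trans\<close>)

text \<open>The linear factor \<open>norm z\<close> is what makes the infinite product converge: the
  arguments of its factors shrink geometrically.\<close>

lemma norm_mask_poly_minus_1_le:
  assumes "finite B" "B \<noteq> {}" "\<And>b. b \<in> B \<Longrightarrow> \<bar>b\<bar> \<le> C"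
  shows "norm (mask_poly B z - 1) \<le> exp (2 * pi * of_int C * norm z) * (2 * pi * of_int C * norm z)"
proof -
  let ?w = "\<lambda>b. - 2 * complex_of_real pi * \<i> * of_int b * z"
  have "norm ((\<Sum>b\<in>B. exp (?w b) - 1) / of_nat (card B)) \<le>
    exp (2 * pi * of_int C * norm z) * (2 * pi * of_int C * norm z)"
  proof (rule norm_sum_divide_card_le[OF assms(1,2)])
    fix b assume b: "b \<in> B"
    have "norm (exp (?w b) - 1) \<le> exp (norm (?w b)) * norm (?w b)"
      using Taylor_exp_field[of "?w b" 0] by (simp del: norm_mult)
    also have "\<dots> \<le> exp (2 * pi * of_int C * norm z) * (2 * pi * of_int C * norm z)"
      using norm_exponent_le[OF assms(3)[OF b], of z] by (intro mult_mono) auto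
    finally show "norm (exp (?w b) - 1) \<le> \<dots>" .
  qed
  also have "(\<Sum>b\<in>B. exp (?w b) - 1) / of_nat (card B) = mask_poly B z - 1"
    using assms by (simp add: mask_poly_def sum_subtractf diff_divide_distrib)
  finally show ?thesis .
qed

section \<open>Convergence, growth and functional equation of the infinite product\<close>

definition moran_factor :: "(nat \<Rightarrow> int) \<Rightarrow> (nat \<Rightarrow> int set) \<Rightarrow> nat \<Rightarrow> complex \<Rightarrow> complex" where
  "moran_factor N B k z = mask_poly (B (Suc k)) (z / of_int (\<Prod>j=1..Suc k. N j))"

text \<open>The entire extension of the Fourier transform of the infinite convolution. Being defined
  without a measure, it applies to the tails of the sequence with no need to construct their limit
  measures.\<close>

definition moran_product :: "(nat \<Rightarrow> int) \<Rightarrow> (nat \<Rightarrow> int set) \<Rightarrow> complex \<Rightarrow> complex" where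
  "moran_product N B z = lim (\<lambda>n. \<Prod>k<n. moran_factor N B k z)"

text \<open>Everything the analytic estimates require. The condition passes to shifted sequences
  with the same \<open>C\<close>, which makes those estimates uniform over all tails.\<close>

definition bounded_digits :: "int \<Rightarrow> (nat \<Rightarrow> int) \<Rightarrow> (nat \<Rightarrow> int set) \<Rightarrow> bool" where
  "bounded_digits C N B \<longleftrightarrow> C \<ge> 0 \<and> (\<forall>k\<ge>1. \<bar>N k\<bar> \<ge> 2 \<and> finite (B k) \<and> B k \<noteq> {} \<and> (\<forall>b\<in>B k. \<bar>b\<bar> \<le> C))"

lemma bounded_digits_shift:
  "bounded_digits C N B \<Longrightarrow> bounded_digits C (\<lambda>k. N (k + n)) (\<lambda>k. B (k + n))"
  unfolding bounded_digits_def by (metis trans_le_add1)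

lemma abs_prod_ge_2_power:
  assumes "\<And>k. k \<ge> 1 \<Longrightarrow> \<bar>N k\<bar> \<ge> (2::int)"
  shows "\<bar>\<Prod>j=1..n. N j\<bar> \<ge> 2 ^ n"
proof (induction n)
  case (Suc n)
  then show ?case using mult_mono[OF Suc assms[of "Suc n"]] by (simp add: abs_mult mult.commute)
qed simp

lemma norm_divide_prod_le:
  assumes "bounded_digits C N B"
  shows "norm (z / of_int (\<Prod>j=1..k. N j) :: complex) \<le> norm z / 2 ^ k"
proof -
  have "2 ^ k \<le> \<bar>\<Prod>j=1..k. N j\<bar>"
    using assms by (intro abs_prod_ge_2_power) (simp add: bounded_digits_def)
  then have "(2::real) ^ k \<le> \<bar>real_of_int (\<Prod>j=1..k. N j)\<bar>"
    by (metis of_int_abs of_int_le_iff of_int_numeral of_int_power)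
  moreover from this have "0 < \<bar>real_of_int (\<Prod>j=1..k. N j)\<bar>"
    by (rule less_le_trans[rotated]) simp
  ultimately show ?thesis
    unfolding norm_divide norm_of_int by (intro divide_left_mono) auto
qed

lemma norm_moran_factor_le:
  assumes "bounded_digits C N B"
  shows "norm (moran_factor N B k z) \<le> exp (2 * pi * of_int C * (norm z / 2 ^ Suc k))"
proof -
  have C: "C \<ge> 0" using assms by (simp add: bounded_digits_def)
  have "norm (moran_factor N B k z) \<le>
      exp (2 * pi * of_int C * norm (z / of_int (\<Prod>j=1..Suc k. N j)))"
    unfolding moran_factor_def
    by (rule norm_mask_poly_le) (use assms in \<open>auto simp: bounded_digits_def\<close>)
  also have "\<dots> \<le> exp (2 * pi * of_int C * (norm z / 2 ^ Suc k))"
    using mult_left_mono[OF norm_divide_prod_le[OF assms, of z "Suc k"], of "2 * pi * of_int C"] C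
    by (simp only: exp_le_cancel_iff) simp
  finally show ?thesis .
qed

lemma norm_moran_factor_minus_1_le:
  assumes "bounded_digits C N B"
  shows "norm (moran_factor N B k z - 1) \<le>
    exp (2 * pi * of_int C * norm z) * (2 * pi * of_int C * norm z) * (1 / 2) ^ k"
proof -
  let ?w = "z / of_int (\<Prod>j=1..Suc k. N j)"
  have C: "C \<ge> 0" using assms by (simp add: bounded_digits_def)
  have w: "norm ?w \<le> norm z / 2 ^ Suc k"
    by (rule norm_divide_prod_le[OF assms])
  also have "\<dots> \<le> norm z / 2 ^ k"
    by (intro divide_left_mono) auto
  finally have w1: "norm ?w \<le> norm z / 2 ^ k" .
  also have "\<dots> \<le> norm z"
    by (simp add: divide_le_eq mult_le_cancel_left1)
  finally have w2: "norm ?w \<le> norm z" .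
  have "norm (moran_factor N B k z - 1) \<le>
      exp (2 * pi * of_int C * norm ?w) * (2 * pi * of_int C * norm ?w)"
    unfolding moran_factor_def
    by (rule norm_mask_poly_minus_1_le) (use assms in \<open>auto simp: bounded_digits_def\<close>)
  also have "\<dots> \<le> exp (2 * pi * of_int C * norm z) * (2 * pi * of_int C * (norm z / 2 ^ k))"
    using C w1 w2 by (intro mult_mono) (auto intro!: mult_left_mono simp del: of_int_prod)
  finally show ?thesis by (simp add: power_divide)
qed

lemma moran_factor_holomorphic: "moran_factor N B k holomorphic_on A"
proof -
  have "(\<lambda>z. mask_poly (B (Suc k)) (z * inverse (of_int (\<Prod>j=1..Suc k. N j)))) holomorphic_on A"
    by (intro holomorphic_intros)
  then show ?thesis
    by (simp add: moran_factor_def[abs_def] divide_inverse)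
qed

lemma uniform_limit_moran_product:
  assumes "bounded_digits C N B"
  shows "uniform_limit (cball 0 R) (\<lambda>n z. \<Prod>k<n. moran_factor N B k z) (moran_product N B) sequentially"
proof -
  have C: "C \<ge> 0" using assms by (simp add: bounded_digits_def)
  have "uniformly_convergent_on (cball 0 R) (\<lambda>n z. \<Sum>k<n. norm (moran_factor N B k z - 1))"
  proof (rule Weierstrass_m_test')
    fix k z assume z: "z \<in> cball (0::complex) R"
    then have R: "0 \<le> R" using order_trans[OF norm_ge_zero, of z R] by simp
    have "norm (moran_factor N B k z - 1) \<le>
      exp (2 * pi * of_int C * norm z) * (2 * pi * of_int C * norm z) * (1 / 2) ^ k"
      by (rule norm_moran_factor_minus_1_le[OF assms])
    also have "\<dots> \<le> exp (2 * pi * of_int C * R) * (2 * pi * of_int C * R) * (1 / 2) ^ k"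
      using z C R by (intro mult_mono) (auto intro!: mult_left_mono)
    finally show "norm (norm (moran_factor N B k z - 1)) \<le>
      exp (2 * pi * of_int C * R) * (2 * pi * of_int C * R) * (1 / 2) ^ k" by simp
  qed (intro summable_mult summable_geometric, simp)
  then have "uniformly_convergent_on (cball 0 R) (\<lambda>n z. \<Prod>k<n. moran_factor N B k z)"
    by (intro uniformly_convergent_on_prod' holomorphic_on_imp_continuous_on moran_factor_holomorphic) auto
  then show ?thesis
    unfolding moran_product_def[abs_def] uniformly_convergent_uniform_limit_iff .
qed

lemma moran_product_LIMSEQ:
  assumes "bounded_digits C N B"
  shows "(\<lambda>n. \<Prod>k<n. moran_factor N B k z) \<longlonglongrightarrow> moran_product N B z"
  using tendsto_uniform_limitI[OF uniform_limit_moran_product[OF assms, of "norm z"], of z] by simp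

lemma moran_product_holomorphic:
  assumes "bounded_digits C N B"
  shows "moran_product N B holomorphic_on UNIV"
proof (rule holomorphic_uniform_sequence)
  fix x :: complex
  have "cball x 1 \<subseteq> cball 0 (norm x + 1)"
    by (simp add: cball_subset_cball_iff)
  then have "uniform_limit (cball x 1) (\<lambda>n z. \<Prod>k<n. moran_factor N B k z) (moran_product N B) sequentially"
    by (rule uniform_limit_on_subset[OF uniform_limit_moran_product[OF assms]])
  then show "\<exists>d>0. cball x d \<subseteq> UNIV \<and>
      uniform_limit (cball x d) (\<lambda>n z. \<Prod>k<n. moran_factor N B k z) (moran_product N B) sequentially"
    by (intro exI[of _ 1]) auto
qed (auto intro!: holomorphic_intros moran_factor_holomorphic)

lemma moran_product_0:
  assumes "bounded_digits C N B"
  shows "moran_product N B 0 = 1"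
proof -
  have "moran_factor N B k 0 = 1" for k
    using assms by (auto simp: moran_factor_def bounded_digits_def intro!: mask_poly_0)
  then have "(\<lambda>n. 1) \<longlonglongrightarrow> moran_product N B 0"
    using moran_product_LIMSEQ[OF assms, of 0] by simp
  then show ?thesis by (simp add: LIMSEQ_const_iff)
qed

text \<open>The scales \<open>1 / 2 ^ Suc k\<close> sum to less than 1, so the whole product obeys
  the growth bound of a single mask polynomial with digits bounded by \<open>C\<close>.\<close>

lemma norm_moran_product_le:
  assumes "bounded_digits C N B"
  shows "norm (moran_product N B z) \<le> exp (2 * pi * of_int C * norm z)"
proof (rule LIMSEQ_le_const2[OF tendsto_norm[OF moran_product_LIMSEQ[OF assms, of z]]])
  have C: "C \<ge> 0" using assms by (simp add: bounded_digits_def)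
  have "norm (\<Prod>k<n. moran_factor N B k z) \<le> exp (2 * pi * of_int C * norm z)" for n
  proof -
    have "norm (\<Prod>k<n. moran_factor N B k z) \<le>
        (\<Prod>k<n. exp (2 * pi * of_int C * (norm z / 2 ^ Suc k)))"
      unfolding prod_norm[symmetric] by (intro prod_mono conjI norm_moran_factor_le[OF assms]) auto
    also have "\<dots> = exp (2 * pi * of_int C * norm z * (\<Sum>k<n. 1 / 2 ^ Suc k))"
      by (simp only: exp_sum[symmetric] finite_lessThan sum_distrib_left) (simp add: mult_ac)
    also have "(\<Sum>k<n. 1 / 2 ^ Suc k) = 1 - (1 / 2 :: real) ^ n"
      by (induction n) (auto simp: field_simps)
    also have "exp (2 * pi * of_int C * norm z * (1 - (1 / 2) ^ n)) \<le> exp (2 * pi * of_int C * norm z)"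
      using C by (simp add: mult_left_le)
    finally show ?thesis .
  qed
  then show "\<exists>n0. \<forall>n\<ge>n0. norm (\<Prod>k<n. moran_factor N B k z) \<le> exp (2 * pi * of_int C * norm z)"
    by blast
qed

text \<open>Splitting off the first factor leaves the product of the shifted sequence at the
  rescaled point, since \<open>N 1\<close> divides out of every later denominator. This equation
  carries zeros from one tail to the next.\<close>

lemma moran_product_rec:
  assumes "bounded_digits C N B"
  shows "moran_product N B z = mask_poly (B 1) (z / of_int (N 1)) *
    moran_product (\<lambda>k. N (Suc k)) (\<lambda>k. B (Suc k)) (z / of_int (N 1))"
proof (rule LIMSEQ_unique)
  let ?N = "\<lambda>k. N (Suc k)" and ?B = "\<lambda>k. B (Suc k)" and ?w = "z / of_int (N 1)"
  have "bounded_digits C ?N ?B"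
    using bounded_digits_shift[OF assms, of 1] by simp
  then have "(\<lambda>n. mask_poly (B 1) ?w * (\<Prod>k<n. moran_factor ?N ?B k ?w)) \<longlonglongrightarrow>
      mask_poly (B 1) ?w * moran_product ?N ?B ?w"
    by (intro tendsto_intros moran_product_LIMSEQ)
  moreover have "mask_poly (B 1) ?w * (\<Prod>k<n. moran_factor ?N ?B k ?w) =
      (\<Prod>k<Suc n. moran_factor N B k z)" for n
  proof -
    have *: "(\<Prod>j=1..Suc (Suc k). N j) = N 1 * (\<Prod>j=1..Suc k. N (Suc j))" for k
      by (subst prod.atLeast_Suc_atMost) (simp_all add: prod.shift_bounds_cl_Suc_ivl[of N "Suc 0", symmetric] del: prod.cl_ivl_Suc)
    have "moran_factor ?N ?B k ?w = moran_factor N B (Suc k) z" for k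
      unfolding moran_factor_def * by simp
    then show ?thesis
      by (simp add: prod.lessThan_Suc_shift moran_factor_def del: prod.lessThan_Suc)
  qed
  ultimately show "(\<lambda>n. \<Prod>k<Suc n. moran_factor N B k z) \<longlonglongrightarrow>
      mask_poly (B 1) ?w * moran_product ?N ?B ?w"
    by simp
  show "(\<lambda>n. \<Prod>k<Suc n. moran_factor N B k z) \<longlonglongrightarrow> moran_product N B z"
    using LIMSEQ_Suc[OF moran_product_LIMSEQ[OF assms, of z]] .
qed

text \<open>The normalization at 0 turns the growth bound into a bound on the number of zeros that
  depends only on \<open>C\<close> and \<open>R\<close>, hence serves all tails at once.\<close>

lemma card_zeros_moran_product_le:
  assumes "bounded_digits C N B" and "finite S" and "S \<subseteq> cball 0 R" and "R > 0"
    and "\<And>a. a \<in> S \<Longrightarrow> moran_product N B a = 0"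
  shows "2 ^ card S \<le> exp (2 * pi * of_int C * (3 * R))"
proof -
  have "norm (moran_product N B 0) * 2 ^ card S \<le> exp (2 * pi * of_int C * (3 * R))"
  proof (rule card_zeros_le)
    show "norm (moran_product N B z) \<le> exp (2 * pi * of_int C * (3 * R))" if "norm z = 3 * R" for z
      using norm_moran_product_le[OF assms(1), of z] that by simp
  qed (use assms moran_product_holomorphic in auto)
  then show ?thesis
    by (simp add: moran_product_0[OF assms(1)])
qed

section \<open>Fourier transforms of infinite convolutions\<close>

lemma char_convolution:
  assumes "real_distribution M" "real_distribution M'"
  shows "char (M \<star> M') t = char M t * char M' t"
proof -
  interpret M: real_distribution M by fact
  interpret M': real_distribution M' by fact
  interpret P: pair_prob_space M M' ..
  have I: "integrable (M \<Otimes>\<^sub>M M') (\<lambda>p. iexp (t * (fst p + snd p)))"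
    by (rule P.integrable_const_bound[where B = 1]) auto
  have "char (M \<star> M') t = (CLINT p|M \<Otimes>\<^sub>M M'. iexp (t * (fst p + snd p)))"
    unfolding char_def convolution_def
    by (subst integral_distr) (auto simp: case_prod_beta)
  also have "\<dots> = (CLINT x|M. CLINT y|M'. iexp (t * (x + y)))"
    using P.integral_fst'[OF I] by simp
  also have "\<dots> = (CLINT x|M. CLINT y|M'. iexp (t * x) * iexp (t * y))"
    by (simp add: ring_distribs exp_add)
  also have "\<dots> = char M t * char M' t"
    by (simp add: char_def)
  finally show ?thesis .
qed

lemma real_distribution_convolution:
  assumes "real_distribution M" "real_distribution M'"
  shows "real_distribution (M \<star> M')"
proof -
  interpret M: real_distribution M by fact
  interpret M': real_distribution M' by fact
  interpret P: pair_prob_space M M' ..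
  have "prob_space (M \<star> M')"
    unfolding convolution_def by (rule P.prob_space_distr) simp
  then show ?thesis
    by (simp add: real_distribution_def real_distribution_axioms_def)
qed

lemma real_distribution_uniform_dirac: "real_distribution (uniform_dirac A)"
proof -
  have "prob_space (uniform_dirac A)"
    unfolding uniform_dirac_def by (rule measure_pmf.prob_space_distr) simp
  then show ?thesis
    by (simp add: real_distribution_def real_distribution_axioms_def uniform_dirac_def)
qed

lemma real_distribution_partial_convolution:
  "real_distribution (partial_convolution (convolution_factor N B) n)"
proof (induction n)
  case 0
  then show ?case
    by (simp add: real_distribution_def real_distribution_axioms_def prob_space_return)
next
  case (Suc n)
  then show ?case
    by (simp add: convolution_factor_def real_distribution_convolution real_distribution_uniform_dirac)
qed

lemma fourier_eq_char: "fourier \<mu> \<xi> = char \<mu> (- 2 * pi * \<xi>)"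
  by (simp add: fourier_def char_def mult_ac)

lemma char_uniform_dirac:
  assumes "finite A" "A \<noteq> {}"
  shows "char (uniform_dirac A) t = (\<Sum>a\<in>A. iexp (t * a)) / of_nat (card A)"
proof -
  have "char (uniform_dirac A) t = (CLINT x|measure_pmf (pmf_of_set A). iexp (t * x))"
    unfolding char_def uniform_dirac_def by (subst integral_distr) auto
  also have "\<dots> = (\<Sum>a\<in>A. pmf (pmf_of_set A) a *\<^sub>R iexp (t * a))"
    by (rule integral_measure_pmf) (use assms in auto)
  also have "\<dots> = (\<Sum>a\<in>A. iexp (t * a)) / of_nat (card A)"
    using assms by (simp add: sum_divide_distrib scaleR_conv_of_real)
  finally show ?thesis .
qed

lemma char_convolution_factor:
  assumes "bounded_digits C N B"
  shows "char (convolution_factor N B (Suc k)) (- 2 * pi * \<xi>) = moran_factor N B k (of_real \<xi>)"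
proof -
  let ?P = "\<Prod>j=1..Suc k. N j"
  let ?f = "\<lambda>b. inverse (real_of_int ?P) * real_of_int b"
  have "?P \<noteq> 0"
    using assms unfolding bounded_digits_def by (subst prod_zero_iff) fastforce+
  \<comment> \<open>Injectivity of the scaling keeps the number of atoms equal to the number of
    digits, so both averages have the same denominator.\<close>
  then have inj: "inj_on ?f (B (Suc k))"
    by (auto simp: inj_on_def simp del: of_int_prod prod.cl_ivl_Suc)
  have fin: "finite (B (Suc k))" "B (Suc k) \<noteq> {}"
    using assms by (auto simp: bounded_digits_def)
  have "char (convolution_factor N B (Suc k)) (- 2 * pi * \<xi>) =
      (\<Sum>b\<in>B (Suc k). iexp (- 2 * pi * \<xi> * ?f b)) / of_nat (card (B (Suc k)))"
    unfolding convolution_factor_def using fin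
    by (subst char_uniform_dirac)
      (simp_all only: finite_imageI image_is_empty sum.reindex[OF inj] card_image[OF inj] o_def simp_thms)
  also have "(\<Sum>b\<in>B (Suc k). iexp (- 2 * pi * \<xi> * ?f b)) =
     (\<Sum>b\<in>B (Suc k). exp (- 2 * complex_of_real pi * \<i> * of_int b * (of_real \<xi> / of_int ?P)))"
    by (intro sum.cong refl arg_cong[where f = exp])
       (simp add: divide_inverse mult_ac del: of_int_prod prod.cl_ivl_Suc)
  finally show ?thesis
    by (simp only: moran_factor_def mask_poly_def)
qed

text \<open>By Levy's continuity theorem the characteristic functions of the partial convolutions
  converge pointwise, and these are the partial products.\<close>

lemma fourier_infinite_convolution:
  assumes "bounded_digits C N B" and "is_infinite_convolution (convolution_factor N B) \<mu>"
  shows "fourier \<mu> \<xi> = moran_product N B (of_real \<xi>)"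
proof (rule LIMSEQ_unique)
  let ?\<nu> = "partial_convolution (convolution_factor N B)"
  have \<mu>: "real_distribution \<mu>" and "weak_limit ?\<nu> \<mu>"
    using assms(2) by (simp_all add: is_infinite_convolution_def)
  then have "weak_conv_m ?\<nu> \<mu>"
    using weak_limit_iff_weak_conv_m[OF real_distribution_partial_convolution \<mu>] by simp
  then have "(\<lambda>n. char (?\<nu> n) (- 2 * pi * \<xi>)) \<longlonglongrightarrow> char \<mu> (- 2 * pi * \<xi>)"
    by (intro levy_continuity1 real_distribution_partial_convolution \<mu>)
  moreover have "char (?\<nu> n) (- 2 * pi * \<xi>) = (\<Prod>k<n. moran_factor N B k (of_real \<xi>))" for n
  proof (induction n)
    case 0
    then show ?case by (simp add: char_def integral_return)
  next
    case (Suc n)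
    have "real_distribution (convolution_factor N B (Suc n))"
      by (simp add: convolution_factor_def real_distribution_uniform_dirac)
    then show ?case
      using Suc char_convolution_factor[OF assms(1), of n \<xi>]
        char_convolution[OF real_distribution_partial_convolution]
      by (simp del: mult_minus_left)
  qed
  ultimately show "(\<lambda>n. \<Prod>k<n. moran_factor N B k (of_real \<xi>)) \<longlonglongrightarrow> fourier \<mu> \<xi>"
    by (simp only: fourier_eq_char)
qed (rule moran_product_LIMSEQ[OF assms(1)])

section \<open>Spectra of admissible pairs\<close>

text \<open>The matrix condition inside \<open>admissible_pair\<close>, named so that one spectrum
  can be fixed for each pair.\<close>

definition is_spectrum :: "int \<Rightarrow> int set \<Rightarrow> int set \<Rightarrow> bool" where
  "is_spectrum N B L \<longleftrightarrow> unitary_on B L (\<lambda>b l.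
     1 / complex_of_real (sqrt (real (card B))) *
     exp (- 2 * complex_of_real pi * \<i> * of_int b * of_int l / of_int N))"

text \<open>Parseval's identity: the mask values are the coordinates of the vector \<open>c\<close>
  multiplied by the matrix \<open>A\<close>. The rows of \<open>A\<close> are orthonormal, and
  \<open>c\<close> is a unit vector because its \<open>card B\<close> entries all have modulus
  \<open>1 / sqrt (card B)\<close>.\<close>

lemma sum_norm_mask_poly_spectrum:
  assumes "is_spectrum N B L" and "B \<noteq> {}"
  shows "(\<Sum>l\<in>L. (norm (mask_poly B (of_real ((\<xi> + of_int l) / of_int N))))\<^sup>2) = 1"
proof -
  define m where "m = complex_of_real (sqrt (real (card B)))"
  define A where "A = (\<lambda>b l. 1 / m * exp (- 2 * complex_of_real pi * \<i> * of_int b * of_int l / of_int N))"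
  define c where "c = (\<lambda>b. exp (- 2 * complex_of_real pi * \<i> * of_int b * of_real \<xi> / of_int N) / m)"
  have fin: "finite B" "finite L"
    and orth: "\<And>b b'. b \<in> B \<Longrightarrow> b' \<in> B \<Longrightarrow> (\<Sum>l\<in>L. A b l * cnj (A b' l)) = (if b = b' then 1 else 0)"
    using assms(1) by (auto simp: is_spectrum_def unitary_on_def A_def m_def)
  have card: "card B > 0" using fin assms(2) by (simp add: card_gt_0_iff)
  have mm: "m * m = of_nat (card B)"
    unfolding m_def of_real_mult[symmetric] by (simp del: of_real_mult)
  have mask: "mask_poly B (of_real ((\<xi> + of_int l) / of_int N)) = (\<Sum>b\<in>B. c b * A b l)" for l
    unfolding mask_poly_def sum_divide_distrib
  proof (rule sum.cong)
    fix b
    have "exp (- 2 * complex_of_real pi * \<i> * of_int b * of_real ((\<xi> + of_int l) / of_int N)) =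
      exp (- 2 * complex_of_real pi * \<i> * of_int b * of_real \<xi> / of_int N) *
      exp (- 2 * complex_of_real pi * \<i> * of_int b * of_int l / of_int N)"
      unfolding exp_add[symmetric] by (simp add: ring_distribs add_divide_distrib)
    then show "exp (- 2 * complex_of_real pi * \<i> * of_int b * of_real ((\<xi> + of_int l) / of_int N)) /
        of_nat (card B) = c b * A b l"
      by (simp add: c_def A_def mm[symmetric])
  qed simp
  have c: "c b * cnj (c b) = 1 / of_nat (card B)" for b
  proof -
    have "norm (exp (- 2 * complex_of_real pi * \<i> * of_int b * of_real \<xi> / of_int N)) = 1"
      by (simp add: norm_exp_eq_Re)
    then have "norm (c b) = 1 / sqrt (real (card B))"
      by (simp only: c_def norm_divide m_def norm_of_real) simp
    then have "(norm (c b))\<^sup>2 = 1 / real (card B)"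
      by (simp add: power_divide)
    then show ?thesis
      unfolding complex_norm_square[symmetric] by simp
  qed
  have "complex_of_real (\<Sum>l\<in>L. (norm (mask_poly B (of_real ((\<xi> + of_int l) / of_int N))))\<^sup>2) =
      (\<Sum>l\<in>L. (\<Sum>b\<in>B. c b * A b l) * cnj (\<Sum>b\<in>B. c b * A b l))"
    unfolding mask of_real_sum complex_norm_square ..
  also have "\<dots> = (\<Sum>l\<in>L. \<Sum>b\<in>B. \<Sum>b'\<in>B. c b * cnj (c b') * (A b l * cnj (A b' l)))"
    by (simp add: sum_product mult_ac)
  also have "\<dots> = (\<Sum>b\<in>B. \<Sum>b'\<in>B. c b * cnj (c b') * (\<Sum>l\<in>L. A b l * cnj (A b' l)))"
    by (simp only: sum.swap[of _ B L] sum_distrib_left)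
  also have "\<dots> = (\<Sum>b\<in>B. \<Sum>b'\<in>B. if b = b' then c b * cnj (c b') else 0)"
    by (intro sum.cong refl) (simp add: orth)
  also have "\<dots> = 1"
    using fin card assms(2) by (simp add: c)
  finally show ?thesis
    by (metis of_real_eq_1_iff)
qed

text \<open>Elements congruent modulo \<open>N\<close> give equal columns of the matrix, whose inner
  product is then 1, whereas distinct columns are orthogonal.\<close>

lemma spectrum_incongruent:
  assumes "is_spectrum N B L" and "N \<noteq> 0" and "l \<in> L" "l' \<in> L" and "N dvd l - l'"
  shows "l = l'"
proof (rule ccontr)
  assume "l \<noteq> l'"
  define A where "A = (\<lambda>b l. 1 / complex_of_real (sqrt (real (card B))) *
    exp (- 2 * complex_of_real pi * \<i> * of_int b * of_int l / of_int N))"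
  obtain k where k: "l = l' + N * k"
    using assms(5) by (metis add.commute diff_add_cancel dvdE)
  have "exp (- 2 * complex_of_real pi * \<i> * of_int b * of_int l / of_int N) =
    exp (- 2 * complex_of_real pi * \<i> * of_int b * of_int l' / of_int N)" for b
  proof -
    have "- 2 * complex_of_real pi * \<i> * of_int b * of_int l / of_int N =
      - 2 * complex_of_real pi * \<i> * of_int b * of_int l' / of_int N
      + complex_of_int (2 * (- b * k)) * complex_of_real pi * \<i>"
      using assms(2) by (simp add: k field_simps)
    then show ?thesis
      unfolding exp_eq by (intro exI[of _ "- b * k"]) simp
  qed
  then have "A b l = A b l'" for b
    by (simp add: A_def)
  then have "(\<Sum>b\<in>B. cnj (A b l) * A b l') = (\<Sum>b\<in>B. cnj (A b l) * A b l)"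
    by simp
  then show False
    using assms(1,3,4) \<open>l \<noteq> l'\<close> unfolding is_spectrum_def unitary_on_def A_def by fastforce
qed

text \<open>The equality case of the triangle inequality: an average of unit complex numbers has
  modulus 1 only if all of them agree. Multiplying by \<open>cnj u\<close> turns the average into 1,
  so every real part, being at most 1, must equal 1. Equal exponentials then give an integer
  difference of phases.\<close>

lemma norm_mask_poly_eq_1_imp_int:
  assumes "finite B" and "norm (mask_poly B (of_real \<eta>)) = 1" and "b \<in> B" "b' \<in> B"
  shows "of_int (b - b') * \<eta> \<in> \<int>"
proof -
  define u where "u = mask_poly B (of_real \<eta>)"
  define e where "e = (\<lambda>b. exp (- 2 * complex_of_real pi * \<i> * of_int b * of_real \<eta>))"
  have e1: "norm (e b) = 1" for b
    by (simp add: e_def norm_exp_eq_Re)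
  have u1: "u * cnj u = 1"
    using assms(2) unfolding complex_norm_square[symmetric] u_def by simp
  have B: "card B > 0" using assms by (auto simp: card_gt_0_iff)
  have "(\<Sum>b\<in>B. e b) = of_nat (card B) * u"
    using B by (simp add: u_def mask_poly_def e_def)
  then have "(\<Sum>b\<in>B. e b * cnj u) = of_nat (card B)"
    by (simp add: sum_distrib_right[symmetric] u1 mult.assoc)
  then have "Re (\<Sum>b\<in>B. e b * cnj u) = real (card B)"
    by simp
  then have "(\<Sum>b\<in>B. 1 - Re (e b * cnj u)) = 0"
    by (simp add: sum_subtractf Re_sum)
  moreover have n1: "norm (e b * cnj u) = 1" for b
    using assms(2) by (simp add: norm_mult e1 u_def)
  moreover have "1 - Re (e b * cnj u) \<ge> 0" for b
    using complex_Re_le_cmod[of "e b * cnj u"] n1[of b] by linarith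
  ultimately have Re1: "Re (e b * cnj u) = 1" if "b \<in> B" for b
    using that assms(1) sum_nonneg_eq_0_iff[of B "\<lambda>b. 1 - Re (e b * cnj u)"] by force
  have "e b = u" if "b \<in> B" for b
  proof -
    have "Im (e b * cnj u) = 0"
      using n1[of b] Re1[OF that] unfolding cmod_def by simp
    then have "e b * cnj u = 1"
      using Re1[OF that] by (intro complex_eqI) simp_all
    then show ?thesis
      using u1 by (metis mult.commute mult.left_commute mult_1_right)
  qed
  then have "e b = e b'" using assms by simp
  then obtain n :: int where "- 2 * complex_of_real pi * \<i> * of_int b * of_real \<eta> =
      - 2 * complex_of_real pi * \<i> * of_int b' * of_real \<eta> + complex_of_int (2 * n) * complex_of_real pi * \<i>"
    unfolding e_def exp_eq by (auto simp: mult_ac)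
  then have "Im (- 2 * complex_of_real pi * \<i> * of_int b * of_real \<eta>) =
      Im (- 2 * complex_of_real pi * \<i> * of_int b' * of_real \<eta> + complex_of_int (2 * n) * complex_of_real pi * \<i>)"
    by (rule arg_cong)
  then have "pi * (of_int (b - b') * \<eta>) = pi * of_int (- n)"
    by (simp add: algebra_simps)
  then have "of_int (b - b') * \<eta> = of_int (- n)"
    by (subst (asm) mult_cancel_left) simp
  then show ?thesis by (metis Ints_of_int)
qed

text \<open>A nonzero multiplier exists, since otherwise the gcd would be 0, so \<xi> is rational.
  Its reduced denominator divides every multiplier and hence their gcd.\<close>

lemma Ints_of_Gcd_eq_1:
  fixes \<xi> :: real
  assumes "\<And>h. h \<in> D \<Longrightarrow> of_int h * \<xi> \<in> \<int>" and "Gcd D = (1::int)"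
  shows "\<xi> \<in> \<int>"
proof -
  obtain h where h: "h \<in> D" "h \<noteq> 0"
    using assms(2) Gcd_0_iff[of D] by auto
  obtain z where "of_int h * \<xi> = of_int z"
    using assms(1)[OF h(1)] by (auto elim: Ints_cases)
  then have "\<xi> = of_int z / of_int h"
    using h(2) by (simp add: field_simps)
  then have "\<xi> \<in> \<rat>" by simp
  then obtain a b :: int where ab: "b > 0" "coprime a b" "\<xi> = of_int a / of_int b"
    by (cases rule: Rats_cases')
  have "b dvd h" if h: "h \<in> D" for h
  proof -
    obtain z where "of_int h * \<xi> = of_int z"
      using assms(1)[OF h] by (auto elim: Ints_cases)
    then have "real_of_int (h * a) = of_int (z * b)"
      using ab by (simp add: field_simps)
    then have "h * a = z * b"
      by (simp only: of_int_eq_iff)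
    then show ?thesis
      using ab(2) by (metis coprime_commute coprime_dvd_mult_left_iff dvd_triv_right)
  qed
  then have "b dvd 1"
    using Gcd_greatest[of D b] assms(2) by simp
  then show ?thesis
    using ab by simp
qed

section \<open>The tree of periodic zeros\<close>

text \<open>A hypothetical periodic zero \<xi> together with one spectrum for each pair. A single
  \<open>R\<close> bounds the root and all spectra, so that [-R, R] is preserved by every map
  sending x to \<open>(x + l) / N k\<close>, because \<open>N k\<close> has modulus at least
  2.\<close>

locale zero_tree =
  fixes N :: "nat \<Rightarrow> int" and B L :: "nat \<Rightarrow> int set" and C :: int and R \<xi> :: real
  assumes digits: "bounded_digits C N B"
    and spectrum: "\<And>k. k \<ge> 1 \<Longrightarrow> is_spectrum (N k) (B k) (L k)"
    and spectrum_bound: "\<And>k l. k \<ge> 1 \<Longrightarrow> l \<in> L k \<Longrightarrow> \<bar>of_int l\<bar> \<le> R"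
    and R_pos: "R > 0"
    and root_bound: "\<bar>\<xi>\<bar> \<le> R"
    and root_zero: "\<And>j :: int. moran_product N B (of_real (\<xi> + of_int j)) = 0"
begin

abbreviation tail :: "nat \<Rightarrow> complex \<Rightarrow> complex" where
  "tail n \<equiv> moran_product (\<lambda>k. N (k + n)) (\<lambda>k. B (k + n))"

primrec nodes :: "nat \<Rightarrow> real set" where
  "nodes 0 = {\<xi>}"
| "nodes (Suc n) = {\<eta>. mask_poly (B (Suc n)) (of_real \<eta>) \<noteq> 0 \<and>
     (\<exists>\<zeta>\<in>nodes n. \<exists>l\<in>L (Suc n). of_int (N (Suc n)) * \<eta> = \<zeta> + of_int l)}"

lemma N_ge_2: "\<bar>N (Suc n)\<bar> \<ge> 2" and B_finite: "finite (B (Suc n))" and B_nonempty: "B (Suc n) \<noteq> {}"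
  using digits by (auto simp: bounded_digits_def)

lemma N_nonzero: "N (Suc n) \<noteq> 0"
  using N_ge_2[of n] by auto

lemma tail_rec:
  "tail n z = mask_poly (B (Suc n)) (z / of_int (N (Suc n))) * tail (Suc n) (z / of_int (N (Suc n)))"
  using moran_product_rec[OF bounded_digits_shift[OF digits, of n], of z] by simp

text \<open>Translating a node by \<open>j\<close> translates its parent by a multiple of
  \<open>N (Suc n)\<close>, so the parent's periodic zero makes the product of mask and next tail
  vanish at every translate. The mask is 1-periodic and nonzero at the node, so the tail
  vanishes.\<close>

lemma node_zero: "\<eta> \<in> nodes n \<Longrightarrow> tail n (of_real (\<eta> + of_int j)) = 0"
proof (induction n arbitrary: \<eta> j)
  case 0
  then show ?case using root_zero by simp
next
  case (Suc n)
  then obtain \<zeta> l where \<eta>: "mask_poly (B (Suc n)) (of_real \<eta>) \<noteq> 0" "\<zeta> \<in> nodes n"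
      "of_int (N (Suc n)) * \<eta> = \<zeta> + of_int l"
    by auto
  have "tail n (of_real (\<zeta> + of_int (l + N (Suc n) * j))) = 0"
    by (rule Suc.IH[OF \<eta>(2)])
  moreover have "of_real (\<zeta> + of_int (l + N (Suc n) * j)) / of_int (N (Suc n)) =
      complex_of_real (\<eta> + of_int j)"
  proof -
    have "\<zeta> + of_int (l + N (Suc n) * j) = of_int (N (Suc n)) * (\<eta> + of_int j)"
      using \<eta>(3) by (simp add: algebra_simps)
    then show ?thesis
      using N_nonzero[of n] by simp
  qed
  ultimately have "mask_poly (B (Suc n)) (of_real (\<eta> + of_int j)) * tail (Suc n) (of_real (\<eta> + of_int j)) = 0"
    by (subst (asm) tail_rec) simp
  moreover have "mask_poly (B (Suc n)) (of_real (\<eta> + of_int j)) \<noteq> 0"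
    using \<eta>(1) mask_poly_add_int[of "B (Suc n)" "of_real \<eta>" j] by simp
  ultimately show ?case by simp
qed

lemma node_bound: "\<eta> \<in> nodes n \<Longrightarrow> \<bar>\<eta>\<bar> \<le> R"
proof (induction n arbitrary: \<eta>)
  case 0
  then show ?case using root_bound by simp
next
  case (Suc n)
  then obtain \<zeta> l where \<eta>: "\<zeta> \<in> nodes n" "l \<in> L (Suc n)" "of_int (N (Suc n)) * \<eta> = \<zeta> + of_int l"
    by auto
  have "2 \<le> \<bar>real_of_int (N (Suc n))\<bar>"
    using N_ge_2[of n] by (metis of_int_abs of_int_le_iff of_int_numeral)
  then have "2 * \<bar>\<eta>\<bar> \<le> \<bar>of_int (N (Suc n)) * \<eta>\<bar>"
    unfolding abs_mult by (rule mult_right_mono) simp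
  also have "\<dots> \<le> R + R"
    unfolding \<eta>(3) using Suc.IH[OF \<eta>(1)] spectrum_bound[OF _ \<eta>(2)] by simp
  finally show ?case by simp
qed

text \<open>Multiplying by \<open>N (Suc n)\<close> turns a congruence of children into one of
  parents, which then coincide by induction. The two spectrum elements are now congruent modulo
  \<open>N (Suc n)\<close> and hence equal.\<close>

lemma node_incongruent: "\<eta> \<in> nodes n \<Longrightarrow> \<eta>' \<in> nodes n \<Longrightarrow> \<eta> = \<eta>' + of_int j \<Longrightarrow> \<eta> = \<eta>'"
proof (induction n arbitrary: \<eta> \<eta>' j)
  case (Suc n)
  obtain \<zeta> l where \<eta>: "\<zeta> \<in> nodes n" "l \<in> L (Suc n)" "of_int (N (Suc n)) * \<eta> = \<zeta> + of_int l"
    using Suc.prems(1) by auto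
  obtain \<zeta>' l' where \<eta>': "\<zeta>' \<in> nodes n" "l' \<in> L (Suc n)" "of_int (N (Suc n)) * \<eta>' = \<zeta>' + of_int l'"
    using Suc.prems(2) by auto
  have *: "\<zeta> = \<zeta>' + of_int (N (Suc n) * j + l' - l)"
    using \<eta>(3) \<eta>'(3) Suc.prems(3) by (simp add: algebra_simps)
  then have "\<zeta> = \<zeta>'" by (rule Suc.IH[OF \<eta>(1) \<eta>'(1)])
  with * have "real_of_int (N (Suc n) * j + l' - l) = 0" by linarith
  then have "N (Suc n) * j + l' - l = 0" by (simp only: of_int_eq_0_iff)
  then have "l - l' = N (Suc n) * j" by simp
  then have "l = l'"
    using spectrum_incongruent[OF spectrum N_nonzero \<eta>(2) \<eta>'(2)] by simp
  with \<open>\<zeta> = \<zeta>'\<close> show ?case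
    using \<eta>(3) \<eta>'(3) N_nonzero[of n] by (metis mult_left_cancel of_int_eq_0_iff)
qed simp

lemma card_nodes_bounded: "\<exists>K. \<forall>n. finite (nodes n) \<and> card (nodes n) \<le> K"
proof (intro exI allI)
  fix n
  let ?E = "exp (2 * pi * of_int C * (3 * R))"
  show "finite (nodes n) \<and> card (nodes n) \<le> nat \<lceil>?E\<rceil>"
  proof (rule finite_if_finite_subsets_card_bdd)
    \<comment> \<open>Bounding every finite subset yields finiteness of the level and the bound on
      its size together.\<close>
    fix G assume G: "G \<subseteq> nodes n" "finite G"
    have "2 ^ card (complex_of_real ` G) \<le> ?E"
    proof (rule card_zeros_moran_product_le[OF bounded_digits_shift[OF digits]])
      show "tail n a = 0" if "a \<in> complex_of_real ` G" for a
        using that G node_zero[of _ n 0] by auto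
      show "complex_of_real ` G \<subseteq> cball 0 R"
        using G node_bound by auto
    qed (use G R_pos in auto)
    moreover have "card (complex_of_real ` G) = card G"
      by (simp add: card_image inj_on_def)
    moreover have "real (card G) \<le> 2 ^ card G"
      using of_nat_less_two_power[of "card G", where ?'a = real] by simp
    ultimately have "real (card G) \<le> ?E" by (metis order_trans)
    then show "card G \<le> nat \<lceil>?E\<rceil>" by linarith
  qed
qed

lemma finite_nodes: "finite (nodes n)"
  using card_nodes_bounded by blast

lemma child:
  assumes "\<zeta> \<in> nodes n" and "l \<in> L (Suc n)"
    and "mask_poly (B (Suc n)) (of_real ((\<zeta> + of_int l) / of_int (N (Suc n)))) \<noteq> 0"
  shows "(\<zeta> + of_int l) / of_int (N (Suc n)) \<in> nodes (Suc n)"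
proof -
  have "of_int (N (Suc n)) * ((\<zeta> + of_int l) / of_int (N (Suc n))) = \<zeta> + of_int l"
    using N_nonzero[of n] by simp
  then show ?thesis
    using assms unfolding nodes.simps by blast
qed

text \<open>The squared mask values over the spectrum sum to 1, so they cannot all vanish.\<close>

lemma has_child:
  assumes "\<zeta> \<in> nodes n"
  shows "\<exists>\<eta>\<in>nodes (Suc n). \<exists>l\<in>L (Suc n). of_int (N (Suc n)) * \<eta> = \<zeta> + of_int l"
proof -
  have "\<exists>l\<in>L (Suc n). mask_poly (B (Suc n)) (of_real ((\<zeta> + of_int l) / of_int (N (Suc n)))) \<noteq> 0"
  proof (rule ccontr)
    assume "\<not> ?thesis"
    then show False
      using sum_norm_mask_poly_spectrum[OF spectrum B_nonempty, of n \<zeta>] by simp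
  qed
  then obtain l where l: "l \<in> L (Suc n)"
      "mask_poly (B (Suc n)) (of_real ((\<zeta> + of_int l) / of_int (N (Suc n)))) \<noteq> 0"
    by blast
  show ?thesis
    using child[OF assms l] l(1) N_nonzero[of n]
    by (intro bexI[of _ "(\<zeta> + of_int l) / of_int (N (Suc n))"] bexI[of _ l]) auto
qed

text \<open>Two parents of one node differ by an integer and are therefore equal. Surjectivity is
  the existence of children.\<close>

lemma parent_map:
  obtains p where "p ` nodes (Suc n) = nodes n"
    and "\<And>\<zeta> \<eta> l. \<zeta> \<in> nodes n \<Longrightarrow> \<eta> \<in> nodes (Suc n) \<Longrightarrow>
      of_int (N (Suc n)) * \<eta> = \<zeta> + of_int l \<Longrightarrow> p \<eta> = \<zeta>"
proof -
  have "\<forall>\<eta>\<in>nodes (Suc n). \<exists>\<zeta>. \<zeta> \<in> nodes n \<and> (\<exists>l. of_int (N (Suc n)) * \<eta> = \<zeta> + of_int l)"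
    by auto
  then obtain p where p: "\<And>\<eta>. \<eta> \<in> nodes (Suc n) \<Longrightarrow> p \<eta> \<in> nodes n"
      "\<And>\<eta>. \<eta> \<in> nodes (Suc n) \<Longrightarrow> \<exists>l. of_int (N (Suc n)) * \<eta> = p \<eta> + of_int l"
    by metis
  have unique: "p \<eta> = \<zeta>" if "\<zeta> \<in> nodes n" "\<eta> \<in> nodes (Suc n)"
    "of_int (N (Suc n)) * \<eta> = \<zeta> + of_int l" for \<zeta> \<eta> l
  proof -
    obtain l' where "of_int (N (Suc n)) * \<eta> = p \<eta> + of_int l'"
      using p(2) \<open>\<eta> \<in> nodes (Suc n)\<close> by blast
    then have "p \<eta> = \<zeta> + of_int (l - l')"
      using that(3) by simp
    then show ?thesis
      by (rule node_incongruent[OF p(1)[OF that(2)] that(1)])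
  qed
  have "p ` nodes (Suc n) = nodes n"
  proof
    show "nodes n \<subseteq> p ` nodes (Suc n)"
    proof
      fix \<zeta> assume \<zeta>: "\<zeta> \<in> nodes n"
      then obtain \<eta> l where \<eta>: "\<eta> \<in> nodes (Suc n)" "of_int (N (Suc n)) * \<eta> = \<zeta> + of_int l"
        using has_child by blast
      show "\<zeta> \<in> p ` nodes (Suc n)"
        using unique[OF \<zeta> \<eta>] \<eta>(1) by (intro rev_image_eqI[OF \<eta>(1)]) simp
    qed
  qed (use p(1) in blast)
  then show thesis
    using unique by (rule that)
qed

section \<open>Stabilization of the level sizes and its arithmetic consequences\<close>

lemma card_nodes_Suc: "card (nodes n) \<le> card (nodes (Suc n))"
  using parent_map card_image_le[OF finite_nodes] by metis

lemma card_nodes_stable: "\<exists>n0. \<forall>n\<ge>n0. card (nodes (Suc n)) = card (nodes n)"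
proof -
  obtain K where K: "\<And>n. card (nodes n) \<le> K" using card_nodes_bounded by blast
  let ?A = "range (\<lambda>n. card (nodes n))"
  have A: "finite ?A"
    by (rule finite_subset[of _ "{..K}"]) (use K in auto)
  then have "Max ?A \<in> ?A"
    by (intro Max_in) auto
  then obtain n0 where "Max ?A = card (nodes n0)" by blast
  then have n0: "card (nodes n) \<le> card (nodes n0)" for n
    using Max_ge[OF A, of "card (nodes n)"] by simp
  have eq: "card (nodes n) = card (nodes n0)" if "n \<ge> n0" for n
    using lift_Suc_mono_le[of "\<lambda>n. card (nodes n)", OF card_nodes_Suc that] n0[of n] by simp
  have "card (nodes (Suc n)) = card (nodes n)" if "n \<ge> n0" for n
    using eq[OF that] eq[of "Suc n"] that by simp
  then show ?thesis by blast
qed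

text \<open>Between levels of equal size the surjective parent map is injective, so \<eta> has no
  siblings. All other terms of the Parseval sum vanish and the term of \<eta> alone equals
  1.\<close>

lemma norm_mask_poly_stable_node:
  assumes "card (nodes (Suc n)) = card (nodes n)" and "\<eta> \<in> nodes (Suc n)"
  shows "norm (mask_poly (B (Suc n)) (of_real \<eta>)) = 1"
proof -
  obtain p where p: "p ` nodes (Suc n) = nodes n"
    "\<And>\<zeta> \<eta> l. \<zeta> \<in> nodes n \<Longrightarrow> \<eta> \<in> nodes (Suc n) \<Longrightarrow>
      of_int (N (Suc n)) * \<eta> = \<zeta> + of_int l \<Longrightarrow> p \<eta> = \<zeta>"
    using parent_map by metis
  have inj: "inj_on p (nodes (Suc n))"
    using p(1) assms(1) by (intro eq_card_imp_inj_on finite_nodes) simp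
  obtain \<zeta> l where \<zeta>: "\<zeta> \<in> nodes n" "l \<in> L (Suc n)" "of_int (N (Suc n)) * \<eta> = \<zeta> + of_int l"
    using assms(2) by auto
  let ?\<eta> = "\<lambda>l. (\<zeta> + of_int l) / of_int (N (Suc n))"
  let ?w = "\<lambda>l. (norm (mask_poly (B (Suc n)) (of_real (?\<eta> l))))\<^sup>2"
  have eq: "of_int (N (Suc n)) * ?\<eta> l' = \<zeta> + of_int l'" for l'
    using N_nonzero[of n] by simp
  have \<eta>: "\<eta> = ?\<eta> l"
    using \<zeta>(3) N_nonzero[of n] by (simp add: field_simps)
  have "?w l' = 0" if l': "l' \<in> L (Suc n) - {l}" for l'
  proof (rule ccontr)
    assume "?w l' \<noteq> 0"
    then have "?\<eta> l' \<in> nodes (Suc n)"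
      using child[OF \<zeta>(1), of l'] l' by simp
    then have "?\<eta> l' = \<eta>"
      using p(2)[OF \<zeta>(1) _ eq, of l'] p(2)[OF \<zeta>(1) assms(2) \<zeta>(3)] inj assms(2)
      by (metis inj_onD)
    then have "l' = l"
      using eq[of l'] \<zeta>(3) by simp
    then show False using l' by simp
  qed
  moreover have "finite (L (Suc n))"
    using spectrum[of "Suc n"] by (simp add: is_spectrum_def unitary_on_def)
  ultimately have "(\<Sum>l\<in>L (Suc n). ?w l) = ?w l"
    using \<zeta>(2) by (simp add: sum.remove[of _ l])
  then have "?w l = 1"
    using sum_norm_mask_poly_spectrum[OF spectrum B_nonempty, of n \<zeta>] by simp
  then show ?thesis
    unfolding \<eta> using norm_ge_zero power2_eq_1_iff by (smt (verit))
qed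

text \<open>A parent equals \<open>N (Suc m)\<close> times its child minus an integer, so
  integrality after multiplication by \<open>h\<close> descends level by level towards the
  root.\<close>

lemma integral_multiplier_down:
  assumes "m \<le> n" and "\<And>\<eta>. \<eta> \<in> nodes n \<Longrightarrow> of_int h * \<eta> \<in> \<int>" and "\<zeta> \<in> nodes m"
  shows "of_int h * \<zeta> \<in> \<int>"
  using assms
proof (induction m arbitrary: \<zeta> rule: inc_induct)
  case (step m)
  obtain \<eta> l where \<eta>: "\<eta> \<in> nodes (Suc m)" "of_int (N (Suc m)) * \<eta> = \<zeta> + of_int l"
    using has_child[OF step.prems(2)] by blast
  have "of_int h * \<zeta> = of_int (N (Suc m)) * (of_int h * \<eta>) - of_int (h * l)"
    using arg_cong[OF \<eta>(2), of "\<lambda>x. of_int h * x"] by (simp add: algebra_simps)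
  then show ?case
    using step.IH[OF step.prems(1) \<eta>(1)] by auto
qed blast

lemma Gcd_recurrent_differences_ne_1:
  assumes rec: "\<And>h k. h \<in> D \<Longrightarrow> \<exists>j\<ge>k. h \<in> difference_set (B j)"
  shows "Gcd D \<noteq> 1"
proof
  assume gcd: "Gcd D = 1"
  obtain n0 where n0: "\<And>n. n \<ge> n0 \<Longrightarrow> card (nodes (Suc n)) = card (nodes n)"
    using card_nodes_stable by blast
  have "of_int h * \<xi> \<in> \<int>" if h: "h \<in> D" for h
  proof -
    obtain j where j: "j \<ge> Suc n0" "h \<in> difference_set (B j)"
      using rec[OF h] by blast
    then obtain n where n: "j = Suc n" "n \<ge> n0" by (cases j) auto
    obtain b b' where b: "b \<in> B (Suc n)" "b' \<in> B (Suc n)" "h = b - b'"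
      using j n by (auto simp: difference_set_def)
    have "of_int h * \<eta> \<in> \<int>" if "\<eta> \<in> nodes (Suc n)" for \<eta>
      unfolding b(3)
      using norm_mask_poly_eq_1_imp_int[OF B_finite norm_mask_poly_stable_node[OF n0[OF n(2)] that] b(1,2)] .
    then show ?thesis
      by (rule integral_multiplier_down[of 0 "Suc n", rotated]) auto
  qed
  then have "\<xi> \<in> \<int>"
    by (rule Ints_of_Gcd_eq_1[OF _ gcd])
  then obtain z where "\<xi> = of_int z" by (auto elim: Ints_cases)
  \<comment> \<open>Translating the root by \<open>- z\<close> puts a zero at the origin, where the
    product has value 1.\<close>
  then show False
    using root_zero[of "- z"] moran_product_0[OF digits] by simp
qed

end

section \<open>Recurrence in a finite alphabet and conclusion\<close>

lemma finite_int_bound: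
  fixes X :: "int set"
  assumes "finite X"
  shows "\<exists>C\<ge>0. \<forall>x\<in>X. \<bar>x\<bar> \<le> C"
  using assms by (intro exI[of _ "Max (insert 0 (abs ` X))"]) auto

text \<open>The indices whose value occurs only finitely often form a finite union of finite sets;
  any \<open>k\<close> beyond that set works.\<close>

lemma finite_range_eventually_recurrent:
  fixes f :: "nat \<Rightarrow> 'a"
  assumes "finite (range f)"
  shows "\<exists>k. \<forall>j\<ge>k. \<forall>m. \<exists>i\<ge>m. f i = f j"
proof -
  define S where "S = (\<Union>x\<in>{x \<in> range f. finite (f -` {x})}. f -` {x})"
  have "finite S"
    unfolding S_def by (rule finite_UN_I) (use assms in simp_all)
  then obtain k where k: "\<And>i. i \<in> S \<Longrightarrow> i < k"
    unfolding finite_nat_set_iff_bounded by blast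
  have "\<exists>i\<ge>m. f i = f j" if "j \<ge> k" for j m
  proof -
    have "infinite (f -` {f j})"
    proof
      assume "finite (f -` {f j})"
      then have "j \<in> S" unfolding S_def by blast
      then show False using k[of j] that by simp
    qed
    then obtain i where "i \<ge> m" "i \<in> f -` {f j}"
      by (metis infinite_nat_iff_unbounded_le)
    then show ?thesis by auto
  qed
  then show ?thesis by blast
qed

theorem corollary1p4:
  fixes N :: "nat \<Rightarrow> int" and B :: "nat \<Rightarrow> int set"
    and F :: "(int \<times> int set) set" and \<mu> :: "real measure"
  assumes "finite F"
    and "\<forall>(M, C) \<in> F. admissible_pair M C"
    and "\<forall>k\<ge>1. (N k, B k) \<in> F"
    and "is_infinite_convolution (convolution_factor N B) \<mu>"
    and "\<forall>k\<ge>1. Gcd (\<Union>j\<in>{k..}. difference_set (B j)) = 1"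
  shows "periodic_zeros \<mu> = {}"
proof (rule ccontr)
  assume "periodic_zeros \<mu> \<noteq> {}"
  then obtain \<xi> where \<xi>: "\<And>j :: int. fourier \<mu> (\<xi> + of_int j) = 0"
    by (auto simp: periodic_zeros_def)
  have adm: "admissible_pair (fst x) (snd x)" if "x \<in> F" for x
    using assms(2) that by auto
  have F: "(N k, B k) \<in> F" if "k \<ge> 1" for k
    using assms(3) that by blast
  have "finite (\<Union>x\<in>F. snd x)"
    using assms(1) adm by (auto simp: admissible_pair_def)
  then obtain C where C: "C \<ge> 0" "\<And>b. b \<in> (\<Union>x\<in>F. snd x) \<Longrightarrow> \<bar>b\<bar> \<le> C"
    using finite_int_bound[of "\<Union>x\<in>F. snd x"] by blast
  have "\<forall>x\<in>F. \<exists>L. is_spectrum (fst x) (snd x) L"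
    using adm unfolding admissible_pair_def is_spectrum_def by blast
  \<comment> \<open>The spectrum is chosen per pair rather than per index, so only finitely many
    spectra occur and a common bound exists.\<close>
  then obtain S where S: "\<And>x. x \<in> F \<Longrightarrow> is_spectrum (fst x) (snd x) (S x)"
    by metis
  have "finite (\<Union>x\<in>F. S x)"
    using assms(1) S by (auto simp: is_spectrum_def unitary_on_def)
  then obtain Q where Q: "Q \<ge> 0" "\<And>l. l \<in> (\<Union>x\<in>F. S x) \<Longrightarrow> \<bar>l\<bar> \<le> Q"
    using finite_int_bound[of "\<Union>x\<in>F. S x"] by blast
  \<comment> \<open>Large enough for all spectra and for the root; the added 1 makes it
    positive.\<close>
  define R where "R = of_int Q + \<bar>\<xi>\<bar> + 1"
  have digits: "bounded_digits C N B"
    unfolding bounded_digits_def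
  proof (intro conjI allI impI)
    fix k :: nat assume "k \<ge> 1"
    note k = F[OF this]
    show "2 \<le> \<bar>N k\<bar>" "finite (B k)" "B k \<noteq> {}"
      using adm[OF k] by (auto simp: admissible_pair_def)
    show "\<forall>b\<in>B k. \<bar>b\<bar> \<le> C"
      using C(2) k by force
  qed (rule C(1))
  interpret zero_tree N B "\<lambda>k. S (N k, B k)" C R \<xi>
  proof
    show "\<bar>of_int l\<bar> \<le> R" if "k \<ge> 1" "l \<in> S (N k, B k)" for k l
    proof -
      have "\<bar>l\<bar> \<le> Q" using Q(2) F[OF that(1)] that(2) by blast
      then have "\<bar>real_of_int l\<bar> \<le> of_int Q" by (metis of_int_abs of_int_le_iff)
      then show ?thesis by (simp add: R_def)
    qed
    show "is_spectrum (N k) (B k) (S (N k, B k))" if "k \<ge> 1" for k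
      using S[OF F[OF that]] by simp
    show "moran_product N B (of_real (\<xi> + of_int j)) = 0" for j
      using fourier_infinite_convolution[OF digits assms(4)] \<xi> by metis
  qed (use digits Q(1) in \<open>auto simp: R_def\<close>)
  \<comment> \<open>The hypotheses concern indices from 1 on, so \<open>B 0\<close> is adjoined
    separately.\<close>
  have "B j \<in> insert (B 0) (snd ` F)" for j
    using F[of j] by (cases j) force+
  then have "range B \<subseteq> insert (B 0) (snd ` F)"
    by blast
  then have "finite (range B)"
    using assms(1) finite_subset by blast
  then obtain k where k: "\<And>j m. j \<ge> k \<Longrightarrow> \<exists>i\<ge>m. B i = B j"
    using finite_range_eventually_recurrent[of B] by blast
  \<comment> \<open>Starting at \<open>Suc k\<close> stays in the recurrent range and also meets the
    lower bound 1 in the gcd hypothesis.\<close>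
  have "Gcd (\<Union>j\<in>{Suc k..}. difference_set (B j)) \<noteq> 1"
  proof (rule Gcd_recurrent_differences_ne_1)
    show "\<exists>i\<ge>m. h \<in> difference_set (B i)"
      if h: "h \<in> (\<Union>j\<in>{Suc k..}. difference_set (B j))" for h m
    proof -
      obtain j where "j \<ge> k" "h \<in> difference_set (B j)"
        using h by (metis UN_E atLeast_iff Suc_leD)
      then show ?thesis using k[of j m] by metis
    qed
  qed
  moreover have "Gcd (\<Union>j\<in>{Suc k..}. difference_set (B j)) = 1"
    by (rule assms(5)[rule_format]) simp
  ultimately show False by (rule notE)
qed

end
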